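(* Let $n\ge1$. For every $\theta\in\Omega$, every $\theta'\in M$, and every $\alpha\in[0,1]$, $$D_\alpha(\theta\,\|\,\theta')=D_\alpha(\theta\,\|\,\theta^\ast)+D_\alpha(\theta^\ast\,\|\,\theta'),\qquad \theta^\ast=(\bar\theta,\dots,\bar\theta),\quad \bar\theta=\frac1n\sum_j\theta^j .$$
   Context: $\Omega:=\{\theta\in\mathbb R^n:\sum_ie^{\theta^i}<1\}$; on $\Omega$, $\Psi_+(\theta):=\log(1+\sum_ie^{\theta^i})$, $\Psi_-(\theta):=-\log(1-\sum_ie^{\theta^i})$, $\Psi_\alpha:=\alpha\Psi_++(1-\alpha)\Psi_-$. $\Psi_\alpha^*(\eta):=\sup_{\theta\in\Omega}[\theta\cdot\eta-\Psi_\alpha(\theta)]$ is the Legendre dual. For $\theta,\theta'\in\Omega$, with $\eta(\theta'):=\nabla\Psi_\alpha(\theta')$, the canonical divergence is $D_\alpha(\theta\,\|\,\theta'):=\Psi_\alpha(\theta)+\Psi_\alpha^*(\eta(\theta'))-\theta\cdot\eta(\theta')$. $M:=\{\theta\in\Omega:\theta^1=\theta^2=\cdots=\theta^n\}$. *)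

theory Defs
  imports "HOL-Analysis.Analysis"
begin

definition Omega :: "(real ^ 'n) set" where
  "Omega = {\<theta>. (\<Sum>i\<in>UNIV. exp (\<theta> $ i)) < 1}"

(* The potentials are only meaningful on Omega; the values elsewhere are never used. *)

definition Psi_plus :: "real ^ 'n \<Rightarrow> real" where
  "Psi_plus \<theta> = ln (1 + (\<Sum>i\<in>UNIV. exp (\<theta> $ i)))"

definition Psi_minus :: "real ^ 'n \<Rightarrow> real" where
  "Psi_minus \<theta> = - ln (1 - (\<Sum>i\<in>UNIV. exp (\<theta> $ i)))"

definition Psi :: "real \<Rightarrow> real ^ 'n \<Rightarrow> real" where
  "Psi \<alpha> \<theta> = \<alpha> * Psi_plus \<theta> + (1 - \<alpha>) * Psi_minus \<theta>"

(* The supremum is taken in the extended reals: for a general eta it may be infinite,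
   and Sup on real is unspecified for sets that are not bounded above. *)
definition Psi_star :: "real \<Rightarrow> real ^ 'n \<Rightarrow> ereal" where
  "Psi_star \<alpha> \<eta> = (SUP \<theta>\<in>Omega. ereal (\<theta> \<bullet> \<eta> - Psi \<alpha> \<theta>))"

definition gradient :: "('a::real_inner \<Rightarrow> real) \<Rightarrow> 'a \<Rightarrow> 'a" where
  "gradient f x = (THE D. GDERIV f x :> D)"

definition eta :: "real \<Rightarrow> real ^ 'n \<Rightarrow> real ^ 'n" where
  "eta \<alpha> \<theta> = gradient (Psi \<alpha>) \<theta>"

definition canonical_divergence :: "real \<Rightarrow> real ^ 'n \<Rightarrow> real ^ 'n \<Rightarrow> ereal" where
  "canonical_divergence \<alpha> \<theta> \<theta>' =
     ereal (Psi \<alpha> \<theta>) + Psi_star \<alpha> (eta \<alpha> \<theta>') - ereal (\<theta> \<bullet> eta \<alpha> \<theta>')"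

definition diagonal :: "(real ^ 'n) set" where
  "diagonal = {\<theta> \<in> Omega. \<forall>i j. \<theta> $ i = \<theta> $ j}"

end

theory Submission
  imports Defs
begin

text \<open>
  Convexity of the potential gives Fenchel's equality, so the canonical divergence is the Bregman
  divergence of the potential. For Bregman divergences the claim amounts to
  \<open>\<theta> - \<theta>\<^sup>*\<close> being orthogonal to the difference of the gradients at \<open>\<theta>\<^sup>*\<close> and \<open>\<theta>'\<close>. Both points lie on the
  diagonal, so by symmetry both gradients are multiples of \<open>(1, \<dots>, 1)\<close>, whereas the coordinates
  of \<open>\<theta> - \<theta>\<^sup>*\<close> sum to zero.
\<close>

text \<open>Factoring out the vector of exponentials shows that the gradient at a diagonal point is
  a multiple of the all-ones vector.\<close>

definition grad_Psi :: "real \<Rightarrow> real ^ 'n \<Rightarrow> real ^ 'n" where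
  "grad_Psi \<alpha> \<theta> =
     (\<alpha> / (1 + (\<Sum>i\<in>UNIV. exp (\<theta> $ i))) + (1 - \<alpha>) / (1 - (\<Sum>i\<in>UNIV. exp (\<theta> $ i))))
       *\<^sub>R (\<chi> i. exp (\<theta> $ i))"

lemma exp_tangent_le: "exp b + exp b * (a - b) \<le> exp (a :: real)"
proof -
  have "exp b * (1 + (a - b)) \<le> exp b * exp (a - b)"
    using exp_ge_add_one_self[of "a - b"] by (intro mult_left_mono) auto
  then show ?thesis
    by (simp add: algebra_simps flip: exp_add)
qed

lemma sum_exp_tangent_le:
  fixes a b :: "'a \<Rightarrow> real"
  shows "(\<Sum>i\<in>A. exp (b i)) + (\<Sum>i\<in>A. exp (b i) * (a i - b i)) \<le> (\<Sum>i\<in>A. exp (a i))"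
  unfolding sum.distrib[symmetric] by (intro sum_mono exp_tangent_le)

text \<open>Frechet derivatives are unique and inner products determine a vector, which resolves the
  definite description in \<open>gradient\<close>.\<close>

lemma gradient_eqI:
  assumes "GDERIV f x :> D"
  shows "gradient f x = D"
  unfolding gradient_def
proof (rule the_equality)
  show "GDERIV f x :> D" by (rule assms)
  fix E assume "GDERIV f x :> E"
  with assms have "(\<lambda>h. h \<bullet> E) = (\<lambda>h. h \<bullet> D)"
    unfolding gderiv_def by (rule has_derivative_unique[rotated])
  then show "E = D"
    by (metis vector_eq_ldot)
qed

lemma GDERIV_Psi:
  fixes \<theta> :: "real ^ 'n"
  assumes "\<theta> \<in> Omega"
  shows "GDERIV (Psi \<alpha>) \<theta> :> grad_Psi \<alpha> \<theta>"
proof -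
  define S where "S = (\<lambda>\<theta> :: real ^ 'n. \<Sum>i\<in>UNIV. exp (\<theta> $ i))"
  have pos: "0 < 1 + S \<theta>" "0 < 1 - S \<theta>"
    using assms by (auto simp: Omega_def S_def intro!: add_pos_nonneg sum_nonneg)
  have S': "(S has_derivative (\<lambda>h. h \<bullet> (\<chi> i. exp (\<theta> $ i)))) (at \<theta>)"
    unfolding S_def
    by (auto intro!: derivative_eq_intros bounded_linear_imp_has_derivative
        bounded_linear_vec_nth simp: inner_vec_def mult.commute)
  have grad: "h \<bullet> grad_Psi \<alpha> \<theta> =
      \<alpha> * (h \<bullet> (\<chi> i. exp (\<theta> $ i)) / (1 + S \<theta>))
        + (1 - \<alpha>) * (h \<bullet> (\<chi> i. exp (\<theta> $ i)) / (1 - S \<theta>))" for h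
    by (simp add: grad_Psi_def S_def distrib_right)
  have "((\<lambda>x. \<alpha> * ln (1 + S x) + (1 - \<alpha>) * - ln (1 - S x)) has_derivative
      (\<lambda>h. h \<bullet> grad_Psi \<alpha> \<theta>)) (at \<theta>)"
    unfolding grad using pos
    by (auto intro!: derivative_eq_intros S' simp: divide_inverse mult.commute)
  then show ?thesis
    unfolding gderiv_def Psi_def Psi_plus_def Psi_minus_def S_def .
qed

lemma eta_eq_grad_Psi: "\<theta> \<in> Omega \<Longrightarrow> eta \<alpha> \<theta> = grad_Psi \<alpha> \<theta>"
  unfolding eta_def by (intro gradient_eqI GDERIV_Psi)

lemma ln_one_plus_sum_exp_tangent_le:
  fixes a b :: "'a \<Rightarrow> real" and A :: "'a set"
  defines "S \<equiv> \<lambda>c. \<Sum>i\<in>A. exp (c i)"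
  shows "ln (1 + S b) + (\<Sum>i\<in>A. exp (b i) * (a i - b i)) / (1 + S b) \<le> ln (1 + S a)"
proof -
  define L where "L = ln (1 + S a) - ln (1 + S b)"
  have pos: "0 < 1 + S c" for c
    unfolding S_def by (intro add_pos_nonneg sum_nonneg) auto
  \<comment> \<open>Normalising by \<open>L\<close> makes the total mass of the shifted exponentials equal to \<open>1 + S b\<close>, so
      summing the tangent inequalities for exp gives Jensen's inequality for the logarithm.\<close>
  have "S b + (\<Sum>i\<in>A. exp (b i) * (a i - L - b i)) \<le> (\<Sum>i\<in>A. exp (a i - L))"
    unfolding S_def by (rule sum_exp_tangent_le)
  moreover have "(\<Sum>i\<in>A. exp (a i - L)) = exp (- L) * S a"
    by (simp add: S_def exp_diff exp_minus sum_distrib_left field_simps)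
  moreover have "exp (- L) * (1 + S a) = 1 + S b"
    using pos[of a] pos[of b] by (simp add: L_def exp_diff)
  \<comment> \<open>The constant 1 counts as one more exponential, with exponent 0; this is its
    tangent inequality after the shift by \<open>L\<close>.\<close>
  moreover have "1 - L \<le> exp (- L)"
    using exp_ge_add_one_self[of "- L"] by simp
  moreover have "(\<Sum>i\<in>A. exp (b i) * (a i - L - b i))
      = (\<Sum>i\<in>A. exp (b i) * (a i - b i)) - L * S b"
    by (simp add: S_def sum_distrib_left algebra_simps flip: sum_subtractf)
  ultimately have "(\<Sum>i\<in>A. exp (b i) * (a i - b i)) \<le> L * (1 + S b)"
    by (simp add: algebra_simps)
  then have "(\<Sum>i\<in>A. exp (b i) * (a i - b i)) / (1 + S b) \<le> L"
    using pos[of b] by (simp only: pos_divide_le_eq)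
  then show ?thesis
    by (simp add: L_def)
qed

text \<open>For s < 1 the function - ln (1 - s) is increasing and convex, and \<open>S\<close> is
  convex in the exponents, so the two tangent inequalities compose.\<close>

lemma ln_one_minus_sum_exp_tangent_le:
  fixes a b :: "'a \<Rightarrow> real" and A :: "'a set"
  defines "S \<equiv> \<lambda>c. \<Sum>i\<in>A. exp (c i)"
  assumes "S a < 1" "S b < 1"
  shows "- ln (1 - S b) + (\<Sum>i\<in>A. exp (b i) * (a i - b i)) / (1 - S b) \<le> - ln (1 - S a)"
proof -
  have "(\<Sum>i\<in>A. exp (b i) * (a i - b i)) / (1 - S b) \<le> (S a - S b) / (1 - S b)"
    using assms sum_exp_tangent_le[where A = A and a = a and b = b] by (intro divide_right_mono) auto
  also have "\<dots> = 1 - (1 - S a) / (1 - S b)"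
    using assms by (simp add: field_simps)
  also have "\<dots> \<le> - ln ((1 - S a) / (1 - S b))"
    using assms ln_le_minus_one[of "(1 - S a) / (1 - S b)"] by simp
  also have "\<dots> = ln (1 - S b) - ln (1 - S a)"
    using assms by (simp add: ln_div)
  finally show ?thesis by simp
qed

text \<open>Here the range of \<alpha> enters: both weights are nonnegative, so the tangent
  inequalities of the two potentials can be added.\<close>

lemma Psi_tangent_le:
  fixes \<theta> \<theta>' :: "real ^ 'n"
  assumes "\<theta> \<in> Omega" "\<theta>' \<in> Omega" "\<alpha> \<in> {0..1}"
  shows "Psi \<alpha> \<theta>' + (\<theta> - \<theta>') \<bullet> grad_Psi \<alpha> \<theta>' \<le> Psi \<alpha> \<theta>"
proof -
  \<comment> \<open>The derivative of the sum of exponentials at \<theta>' in the direction \<theta>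
    - \<theta>'.\<close>
  define T where "T = (\<Sum>i\<in>UNIV. exp (\<theta>' $ i) * (\<theta> $ i - \<theta>' $ i))"
  define S where "S = (\<Sum>i\<in>UNIV. exp (\<theta>' $ i))"
  have "\<alpha> * (Psi_plus \<theta>' + T / (1 + S)) \<le> \<alpha> * Psi_plus \<theta>"
    using assms ln_one_plus_sum_exp_tangent_le
      [where A = UNIV and a = "($) \<theta>" and b = "($) \<theta>'"]
    by (intro mult_left_mono) (auto simp: Psi_plus_def T_def S_def)
  moreover have "(1 - \<alpha>) * (Psi_minus \<theta>' + T / (1 - S)) \<le> (1 - \<alpha>) * Psi_minus \<theta>"
    using assms ln_one_minus_sum_exp_tangent_le
      [where A = UNIV and a = "($) \<theta>" and b = "($) \<theta>'"]
    by (intro mult_left_mono) (auto simp: Psi_minus_def T_def S_def Omega_def)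
  moreover have "(\<theta> - \<theta>') \<bullet> grad_Psi \<alpha> \<theta>' = \<alpha> * (T / (1 + S)) + (1 - \<alpha>) * (T / (1 - S))"
  proof -
    have "(\<theta> - \<theta>') \<bullet> (\<chi> i. exp (\<theta>' $ i)) = T"
      by (simp add: inner_vec_def T_def mult.commute)
    then show ?thesis
      by (simp add: grad_Psi_def S_def distrib_right)
  qed
  ultimately show ?thesis
    unfolding Psi_def by (simp only: distrib_left)
qed

text \<open>Rearranged, the tangent inequality at \<theta>' says that the supremum is attained at
  \<theta>'; in particular it is finite.\<close>

lemma Psi_star_eta:
  fixes \<theta>' :: "real ^ 'n"
  assumes "\<theta>' \<in> Omega" "\<alpha> \<in> {0..1}"
  shows "Psi_star \<alpha> (eta \<alpha> \<theta>') = ereal (\<theta>' \<bullet> grad_Psi \<alpha> \<theta>' - Psi \<alpha> \<theta>')"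
  unfolding Psi_star_def eta_eq_grad_Psi[OF assms(1)]
proof (rule antisym)
  show "(SUP \<theta>\<in>Omega. ereal (\<theta> \<bullet> grad_Psi \<alpha> \<theta>' - Psi \<alpha> \<theta>))
      \<le> ereal (\<theta>' \<bullet> grad_Psi \<alpha> \<theta>' - Psi \<alpha> \<theta>')"
    using Psi_tangent_le[OF _ assms]
    by (intro SUP_least) (simp add: inner_diff_left algebra_simps)
qed (rule SUP_upper[OF assms(1)])

lemma canonical_divergence_eq_Bregman:
  fixes \<theta> \<theta>' :: "real ^ 'n"
  assumes "\<theta>' \<in> Omega" "\<alpha> \<in> {0..1}"
  shows "canonical_divergence \<alpha> \<theta> \<theta>'
    = ereal (Psi \<alpha> \<theta> - Psi \<alpha> \<theta>' - (\<theta> - \<theta>') \<bullet> grad_Psi \<alpha> \<theta>')"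
  unfolding canonical_divergence_def Psi_star_eta[OF assms]
  using assms(1) by (simp add: eta_eq_grad_Psi inner_diff_left)

text \<open>By Jensen's inequality, replacing all coordinates by their mean does not increase the
  sum of exponentials.\<close>

lemma mean_in_Omega:
  fixes \<theta> :: "real ^ 'n"
  assumes "\<theta> \<in> Omega"
  shows "(\<chi> i. (1 / real CARD('n)) * (\<Sum>j\<in>UNIV. \<theta> $ j)) \<in> (Omega :: (real ^ 'n) set)"
proof -
  define m where "m = (1 / real CARD('n)) * (\<Sum>j\<in>UNIV. \<theta> $ j)"
  have "(\<Sum>i\<in>(UNIV :: 'n set). exp m) + (\<Sum>i\<in>UNIV. exp m * (\<theta> $ i - m)) \<le> (\<Sum>i\<in>UNIV. exp (\<theta> $ i))"
    by (rule sum_exp_tangent_le)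
  \<comment> \<open>With tangents taken at the mean, the first-order terms cancel.\<close>
  moreover have "(\<Sum>i\<in>UNIV. exp m * (\<theta> $ i - m)) = 0"
    by (simp add: m_def sum_subtractf flip: sum_distrib_left)
  ultimately show ?thesis
    using assms by (simp add: Omega_def m_def)
qed

lemma inner_grad_Psi_diagonal:
  fixes \<theta>' v :: "real ^ 'n"
  assumes "\<theta>' \<in> diagonal" "(\<Sum>i\<in>UNIV. v $ i) = 0"
  shows "v \<bullet> grad_Psi \<alpha> \<theta>' = 0"
proof -
  obtain c where "\<theta>' $ i = c" for i
    using assms(1) unfolding diagonal_def by blast
  then have "v \<bullet> (\<chi> i. exp (\<theta>' $ i)) = (\<Sum>i\<in>UNIV. v $ i) * exp c"
    by (simp add: inner_vec_def sum_distrib_right)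
  then show ?thesis
    using assms(2) by (simp add: grad_Psi_def)
qed

theorem theorem7p5:
  fixes \<theta> \<theta>' \<theta>star :: "real ^ 'n" and \<alpha> :: real
  assumes "\<theta> \<in> Omega"
    and "\<theta>' \<in> diagonal"
    and "\<alpha> \<in> {0..1}"
    and "\<theta>star = (\<chi> i. (1 / real CARD('n)) * (\<Sum>j\<in>UNIV. \<theta> $ j))"
  shows "canonical_divergence \<alpha> \<theta> \<theta>' =
         canonical_divergence \<alpha> \<theta> \<theta>star + canonical_divergence \<alpha> \<theta>star \<theta>'"
proof -
  have star: "\<theta>star \<in> Omega"
    using mean_in_Omega[OF assms(1)] assms(4) by simp
  then have "\<theta>star \<in> diagonal"
    using assms(4) by (simp add: diagonal_def)
  moreover have "(\<Sum>i\<in>UNIV. (\<theta> - \<theta>star) $ i) = 0"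
    by (simp add: assms(4) sum_subtractf)
  ultimately have "(\<theta> - \<theta>star) \<bullet> grad_Psi \<alpha> \<theta>star = 0" "(\<theta> - \<theta>star) \<bullet> grad_Psi \<alpha> \<theta>' = 0"
    using assms(2) by (blast intro: inner_grad_Psi_diagonal)+
  moreover have "\<theta>' \<in> Omega"
    using assms(2) by (simp add: diagonal_def)
  \<comment> \<open>The values of \<open>Psi\<close> telescope; the two sides then differ only by
    the inner products of \<open>\<theta> - \<theta>star\<close> with the two gradients, both
    zero.\<close>
  ultimately show ?thesis
    using star assms(3) by (simp add: canonical_divergence_eq_Bregman inner_diff_left)
qed

end
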